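(* Let $A\in\mathbb{R}^{M\times N}$ be $s$-regular, i.e. any $s$ columns of $A$ are linearly independent (equivalently, $d^\top A^\top A d>0$ for all $d\neq0$ with $\|d\|_0\le s$), let $b\in\mathbb{R}^M$, and let $S=\{x\in\mathbb{R}^N:\|x\|_0\le s\}$. Let $\{x^k\}$ be the sequence generated by the gradient support projection algorithm (GSPA) for the problem $\min r(x)=\frac12\|Ax-b\|^2$ subject to $x\in S\cap\mathbb{R}^N_+$. Then $\{x^k\}$ converges to a local minimizer of this problem.
   Context: $s<M<N$ are positive integers; $\|x\|_0$ is the number of nonzero entries of $x$ and $\mathrm{supp}(x)$ the set of indices of nonzero entries; $\|\cdot\|$ is the Euclidean norm; $L_r=\lambda_{\max}(A^\top A)$. Put $\Omega=S\cap\mathbb{R}^N_+$; $P_\Omega(x)$ is the projection $\arg\min_{y\in\Omega}\|x-y\|$ (when it is not a singleton, "$y=P_\Omega(x)$" means that some element is selected). GSPA: Step 0: $x^0=0$, $\Gamma^0=\mathrm{supp}(P_\Omega(A^\top b))$, parameters $0<\alpha_0<\frac1{L_r}$, $0<\sigma\le\frac1{4L_r}$, $0<\beta<1$. For $k=0,1,2,\dots$: Step 1: compute $\tilde x^{k+1}=P_\Omega(x^k-\alpha_0\nabla r(x^k))$. Step 2: if $\mathrm{supp}(\tilde x^{k+1})=\Gamma^k$, set $x^{k+1}=\tilde x^{k+1}$ (with stepsize $\alpha_k=\alpha_0$) and $\Gamma^{k+1}=\mathrm{supp}(x^{k+1})$; else set $x^{k+1}=P_\Omega(x^k-\alpha_k\nabla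 r(x^k))=x^k(\alpha_k)$, $\Gamma^{k+1}=\mathrm{supp}(x^{k+1})$, where $x^k(\alpha)=P_\Omega(x^k-\alpha\nabla r(x^k))$, $\alpha_k=\alpha_0\beta^{m_k}$ and $m_k$ is the smallest positive integer $m$ with $$r(x^k(\alpha_0\beta^m))\le r(x^k)-\frac{\sigma}{2}\,\frac{\|x^k(\alpha_0\beta^m)-x^k\|^2}{(\alpha_0\beta^m)^2}.$$ The practical stopping test ($\|x^{k+1}-x^k\|\le\epsilon$) is disregarded, so that an infinite sequence is generated; it is assumed that the line search in Step 2 always succeeds. *)

theory Defs
  imports "HOL-Analysis.Analysis"
begin

definition supp :: "real ^ 'n \<Rightarrow> 'n set" where
  "supp x = {i. x $ i \<noteq> 0}"

definition sparse_set :: "nat \<Rightarrow> (real ^ 'n) set" where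
  "sparse_set s = {x. card (supp x) \<le> s}"

definition nonneg_orthant :: "(real ^ 'n) set" where
  "nonneg_orthant = {x. \<forall>i. 0 \<le> x $ i}"

definition feasible :: "nat \<Rightarrow> (real ^ 'n) set" where
  "feasible s = sparse_set s \<inter> nonneg_orthant"

text \<open>Columns are treated as an indexed family, so two equal columns count as
  linearly dependent; hence the injectivity requirement.\<close>

definition s_regular :: "nat \<Rightarrow> real ^ 'n ^ 'm \<Rightarrow> bool" where
  "s_regular s A \<longleftrightarrow>
     (\<forall>T. card T = s \<longrightarrow>
        inj_on (\<lambda>j. column j A) T \<and> independent ((\<lambda>j. column j A) ` T))"

definition real_eigenvalues :: "real ^ 'n ^ 'n \<Rightarrow> real set" where
  "real_eigenvalues B = {c. \<exists>v. v \<noteq> 0 \<and> B *v v = c *\<^sub>R v}"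

definition lambda_max :: "real ^ 'n ^ 'n \<Rightarrow> real" where
  "lambda_max B = Max (real_eigenvalues B)"

definition objective :: "real ^ 'n ^ 'm \<Rightarrow> real ^ 'm \<Rightarrow> real ^ 'n \<Rightarrow> real" where
  "objective A b x = 1/2 * (norm (A *v x - b))\<^sup>2"

definition lipschitz_const :: "real ^ 'n ^ 'm \<Rightarrow> real" where
  "lipschitz_const A = lambda_max (transpose A ** A)"

definition grad :: "('a::real_inner \<Rightarrow> real) \<Rightarrow> 'a \<Rightarrow> 'a" where
  "grad f x = (THE g. GDERIV f x :> g)"

text \<open>The projection onto a nonconvex set is set-valued.\<close>

definition proj :: "'a::metric_space set \<Rightarrow> 'a \<Rightarrow> 'a set" where
  "proj \<Omega> x = {y. is_arg_min (\<lambda>y. dist x y) (\<lambda>y. y \<in> \<Omega>) y}"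

definition local_minimizer :: "('a::metric_space \<Rightarrow> real) \<Rightarrow> 'a set \<Rightarrow> 'a \<Rightarrow> bool" where
  "local_minimizer f \<Omega> x \<longleftrightarrow> x \<in> \<Omega> \<and> (\<exists>e>0. \<forall>y \<in> \<Omega> \<inter> ball x e. f x \<le> f y)"

definition sufficient_decrease ::
  "('a::real_normed_vector \<Rightarrow> real) \<Rightarrow> real \<Rightarrow> 'a \<Rightarrow> real \<Rightarrow> 'a \<Rightarrow> bool" where
  "sufficient_decrease r \<sigma> x \<alpha> y \<longleftrightarrow>
     r y \<le> r x - \<sigma> / 2 * ((norm (y - x))\<^sup>2 / \<alpha>\<^sup>2)"

text \<open>One iteration from \<open>(x, \<Gamma>)\<close> to \<open>(x', \<Gamma>')\<close>. Here \<open>xt\<close> is the point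
  selected in the first step, and \<open>X \<alpha>\<close> the point selected for the trial stepsize
  \<open>\<alpha>\<close> in the line search. Every selection from a projection is arbitrary and may
  vary between iterations. The line search is required to succeed with a least
  positive exponent \<open>m\<close>.\<close>

definition gspa_step ::
  "(real ^ 'n) set \<Rightarrow> (real ^ 'n \<Rightarrow> real) \<Rightarrow> real \<Rightarrow> real \<Rightarrow> real \<Rightarrow>
   real ^ 'n \<Rightarrow> 'n set \<Rightarrow> real ^ 'n \<Rightarrow> 'n set \<Rightarrow> bool" where
  "gspa_step \<Omega> r \<alpha>\<^sub>0 \<sigma> \<beta> x \<Gamma> x' \<Gamma>' \<longleftrightarrow>
     (\<exists>xt \<in> proj \<Omega> (x - \<alpha>\<^sub>0 *\<^sub>R grad r x).
        if supp xt = \<Gamma> then x' = xt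
        else \<exists>X m.
          (\<forall>\<alpha>>0. X \<alpha> \<in> proj \<Omega> (x - \<alpha> *\<^sub>R grad r x)) \<and>
          is_arg_min id
            (\<lambda>m::nat. m > 0 \<and> sufficient_decrease r \<sigma> x (\<alpha>\<^sub>0 * \<beta> ^ m) (X (\<alpha>\<^sub>0 * \<beta> ^ m))) m \<and>
          x' = X (\<alpha>\<^sub>0 * \<beta> ^ m)) \<and>
     \<Gamma>' = supp x'"

definition gspa_sequence ::
  "real ^ 'n ^ 'm \<Rightarrow> real ^ 'm \<Rightarrow> nat \<Rightarrow> real \<Rightarrow> real \<Rightarrow> real \<Rightarrow> (nat \<Rightarrow> real ^ 'n) \<Rightarrow> bool" where
  "gspa_sequence A b s \<alpha>\<^sub>0 \<sigma> \<beta> x \<longleftrightarrow>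
     0 < \<alpha>\<^sub>0 \<and> \<alpha>\<^sub>0 < 1 / lipschitz_const A \<and>
     0 < \<sigma> \<and> \<sigma> \<le> 1 / (4 * lipschitz_const A) \<and>
     0 < \<beta> \<and> \<beta> < 1 \<and>
     x 0 = 0 \<and>
     (\<exists>\<Gamma>. (\<exists>y \<in> proj (feasible s) (transpose A *v b). \<Gamma> 0 = supp y) \<and>
       (\<forall>k. gspa_step (feasible s) (objective A b) \<alpha>\<^sub>0 \<sigma> \<beta> (x k) (\<Gamma> k) (x (Suc k)) (\<Gamma> (Suc k))))"

lemma GDERIV_objective:
  "GDERIV (objective A b) x :> transpose A *v (A *v x - b)"
proof -
  have lin: "((\<lambda>x. A *v x) has_derivative (\<lambda>h. A *v h)) (at x)"
    by (rule bounded_linear_imp_has_derivative[OF matrix_vector_mul_bounded_linear])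
  have sub: "((\<lambda>x. A *v x - b) has_derivative (\<lambda>h. A *v h)) (at x)"
    using has_derivative_diff[OF lin has_derivative_const[of b]] by simp
  have "((\<lambda>x. (1/2) *\<^sub>R ((A *v x - b) \<bullet> (A *v x - b))) has_derivative
      (\<lambda>h. (1/2) *\<^sub>R ((A *v x - b) \<bullet> (A *v h) + (A *v h) \<bullet> (A *v x - b)))) (at x)"
    by (rule has_derivative_scaleR_right[OF has_derivative_inner[OF sub sub]])
  moreover have "(1/2) *\<^sub>R ((A *v x - b) \<bullet> (A *v h) + (A *v h) \<bullet> (A *v x - b))
      = h \<bullet> (transpose A *v (A *v x - b))" for h
  proof -
    have "h \<bullet> (transpose A *v (A *v x - b)) = (A *v x - b) \<bullet> (A *v h)"
      by (metis dot_lmul_matrix inner_commute transpose_matrix_vector)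
    then show ?thesis by (simp add: inner_commute)
  qed
  ultimately show ?thesis
    by (simp add: gderiv_def objective_def[abs_def] power2_norm_eq_inner)
qed

lemma grad_objective:
  "grad (objective A b) x = transpose A *v (A *v x - b)"
  unfolding grad_def
proof (rule the_equality)
  show "GDERIV (objective A b) x :> transpose A *v (A *v x - b)"
    by (rule GDERIV_objective)
next
  fix g assume "GDERIV (objective A b) x :> g"
  then have "(\<lambda>h. h \<bullet> g) = (\<lambda>h. h \<bullet> (transpose A *v (A *v x - b)))"
    using GDERIV_objective[of A b x] unfolding gderiv_def by (rule has_derivative_unique)
  then show "g = transpose A *v (A *v x - b)"
    by (metis vector_eq_ldot)
qed

end

theory Submission
  imports Defs
begin

text \<open>Both kinds of step satisfy \<open>r (x (k+1)) \<le> r (x k) - c * (norm (x (k+1) - x k) / \<alpha>)\<^sup>2\<close> with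
  one constant \<open>c > 0\<close>, so \<open>norm (x (k+1) - x k) / \<alpha>\<close> tends to zero. On the support of
  \<open>x (k+1)\<close> this quotient bounds the partial derivatives at \<open>x k\<close>, hence every limit point is
  stationary on its own support; by \<open>s\<close>-regularity there are only finitely many such points, and
  a bounded sequence with vanishing increments converges to one of them, \<open>p\<close>.

  Such a \<open>p\<close> is a local minimizer unless its support has fewer than \<open>s\<close> elements and some
  partial derivative off the support is negative. In that case the unselected coordinate forces
  all selected ones to be at least of order \<open>\<alpha>\<close>, so the supports of the iterates eventually
  freeze at a set of size \<open>s\<close> and \<open>\<alpha>\<close> tends to zero. The iteration is then plain gradient
  descent on that set, which by convexity decreases \<open>r\<close> by at most
  \<open>norm (x (k+1) - x k)\<^sup>2 / \<alpha>\<close>. For \<open>\<alpha> < c\<close> this contradicts the guaranteed decrease unless the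
  sequence is eventually constant, and then \<open>p\<close> would have full support.\<close>

section \<open>The Gram matrix and its largest eigenvalue\<close>

lemma norm_matrix_vector_eq:
  fixes A :: "real ^ 'n ^ 'm"
  shows "(norm (A *v d))\<^sup>2 = d \<bullet> ((transpose A ** A) *v d)"
  by (metis dot_lmul_matrix inner_commute matrix_vector_mul_assoc power2_norm_eq_inner
      transpose_matrix_vector)

lemma gram_symmetric:
  fixes A :: "real ^ 'n ^ 'm"
  shows "v \<bullet> ((transpose A ** A) *v w) = ((transpose A ** A) *v v) \<bullet> w"
  by (metis dot_lmul_matrix inner_commute matrix_vector_mul_assoc transpose_matrix_vector)

text \<open>Eigenvectors for distinct eigenvalues of a symmetric matrix are orthogonal, hence
  independent, so choosing one per eigenvalue yields a finite set. Finiteness is what gives the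
  \<open>Max\<close> in \<open>lambda_max\<close> its meaning.\<close>

lemma finite_real_eigenvalues:
  fixes B :: "real ^ 'n ^ 'n"
  assumes sym: "\<And>v w. v \<bullet> (B *v w) = (B *v v) \<bullet> w"
  shows "finite (real_eigenvalues B)"
proof -
  define f where "f c = (SOME v. v \<noteq> 0 \<and> B *v v = c *\<^sub>R v)" for c
  have f: "f c \<noteq> 0 \<and> B *v f c = c *\<^sub>R f c" if "c \<in> real_eigenvalues B" for c
    using that someI_ex[of "\<lambda>v. v \<noteq> 0 \<and> B *v v = c *\<^sub>R v"]
    unfolding real_eigenvalues_def f_def by auto
  have orth: "f c \<bullet> f d = 0"
    if "c \<in> real_eigenvalues B" "d \<in> real_eigenvalues B" "c \<noteq> d" for c d
    using sym[of "f c" "f d"] f[OF that(1)] f[OF that(2)] that(3) by simp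
  have inj: "inj_on f (real_eigenvalues B)"
    using f orth by (metis inj_onI inner_eq_zero_iff)
  have "pairwise orthogonal (f ` real_eigenvalues B)"
    unfolding pairwise_def orthogonal_def using orth by auto
  moreover have "0 \<notin> f ` real_eigenvalues B"
    using f by fastforce
  ultimately have "finite (f ` real_eigenvalues B)"
    using pairwise_orthogonal_independent independent_imp_finite by blast
  then show ?thesis
    using inj finite_imageD by blast
qed

text \<open>A maximizer of the Rayleigh quotient on the unit sphere is an eigenvector.\<close>

lemma norm_le_lipschitz_const:
  fixes A :: "real ^ 'n ^ 'm"
  shows "(norm (A *v d))\<^sup>2 \<le> lipschitz_const A * (norm d)\<^sup>2"
proof -
  define B where "B = transpose A ** A"
  have "continuous_on (sphere 0 1) (\<lambda>v::real^'n. (norm (A *v v))\<^sup>2)"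
    by (intro continuous_intros linear_continuous_on matrix_vector_mul_bounded_linear)
  moreover have "(sphere 0 1 :: (real^'n) set) \<noteq> {}" by simp
  ultimately obtain v :: "real^'n" where v: "norm v = 1"
    and vmax: "\<And>y::real^'n. norm y = 1 \<Longrightarrow> (norm (A *v y))\<^sup>2 \<le> (norm (A *v v))\<^sup>2"
    using continuous_attains_sup[OF compact_sphere, of 0 1 "\<lambda>v::real^'n. (norm (A *v v))\<^sup>2"]
    by (auto simp: dist_norm)
  define M where "M = (norm (A *v v))\<^sup>2"
  \<comment> \<open>The quadratic form of \<open>M\<close> times the identity minus
    \<open>B\<close>. It is nonnegative and vanishes at \<open>v\<close>, so its first-order term at
    \<open>v\<close> must vanish too.\<close>
  define q where "q d = M * (d \<bullet> d) - d \<bullet> (B *v d)" for d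
  have q: "q d = M * (norm d)\<^sup>2 - (norm (A *v d))\<^sup>2" for d
    unfolding q_def B_def norm_matrix_vector_eq by (simp add: power2_norm_eq_inner)
  have q0: "0 \<le> q d" for d
  proof (cases "d = 0")
    case False
    have "(norm (A *v ((1 / norm d) *\<^sub>R d)))\<^sup>2 \<le> M"
      unfolding M_def by (rule vmax) (use False in simp)
    then have "(norm (A *v d))\<^sup>2 \<le> M * (norm d)\<^sup>2"
      using False by (simp add: matrix_vector_mult_scaleR power_divide field_simps)
    then show ?thesis
      by (simp add: q)
  qed (simp add: q_def)
  have symB: "v \<bullet> (B *v w) = (B *v v) \<bullet> w" for v w
    unfolding B_def by (rule gram_symmetric)
  \<comment> \<open>Half the gradient of \<open>q\<close> at \<open>v\<close>. Moving from
    \<open>v\<close> by a small \<open>t\<close> against \<open>w\<close> would make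
    \<open>q\<close> negative unless \<open>w\<close> is zero, which is the eigenvector
    equation.\<close>
  define w where "w = M *\<^sub>R v - B *v v"
  have vv: "v \<bullet> v = 1"
    using v by (metis power2_norm_eq_inner one_power2)
  have qv: "v \<bullet> (B *v v) = M"
    by (simp add: M_def B_def norm_matrix_vector_eq)
  have qt: "q (v - t *\<^sub>R w) = t\<^sup>2 * q w - 2 * t * (w \<bullet> w)" for t
  proof -
    have "v \<bullet> (B *v w) = w \<bullet> (B *v v)" using symB by (simp add: inner_commute)
    then have "q (v - t *\<^sub>R w) = M * (v \<bullet> v) - v \<bullet> (B *v v) + t\<^sup>2 * q w - 2 * t * (w \<bullet> (M *\<^sub>R v - B *v v))"
      unfolding q_def
      by (simp add: matrix_vector_mult_diff_distrib matrix_vector_mult_scaleR inner_diff_left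
          inner_diff_right inner_commute[of v w] power2_eq_square[of t] algebra_simps)
    then show ?thesis by (simp add: vv qv flip: w_def)
  qed
  have bound: "2 * (w \<bullet> w) \<le> t * q w" if "t > 0" for t
    using q0[of "v - t *\<^sub>R w"] that unfolding qt
    by (simp add: power2_eq_square)
  have "w \<bullet> w \<le> 0"
  proof (rule ccontr)
    assume "\<not> w \<bullet> w \<le> 0"
    then have pos: "w \<bullet> w > 0" by (simp only: not_le)
    moreover have "2 * (w \<bullet> w) \<le> q w" using bound[of 1] by simp
    ultimately have "q w > 0" by linarith
    then show False using bound[of "(w \<bullet> w) / q w"] pos by simp
  qed
  then have "w = 0" by (meson inner_gt_zero_iff not_le)
  then have "M \<in> real_eigenvalues B"
    unfolding real_eigenvalues_def w_def using v by (auto intro!: exI[of _ v])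
  then have "M \<le> lipschitz_const A"
    unfolding lipschitz_const_def lambda_max_def B_def[symmetric]
    using finite_real_eigenvalues[OF symB] by simp
  moreover have "(norm (A *v d))\<^sup>2 \<le> M * (norm d)\<^sup>2"
    using q0[of d] by (simp add: q)
  ultimately show ?thesis
    by (meson mult_right_mono order_trans zero_le_power2)
qed

section \<open>Consequences of s-regularity\<close>

lemma s_regular_injective:
  fixes A :: "real ^ 'n ^ 'm"
  assumes reg: "s_regular s A" and "s \<le> CARD('n)"
    and "card (supp d) \<le> s" and "A *v d = 0"
  shows "d = 0"
proof -
  \<comment> \<open>Regularity speaks of exactly \<open>s\<close> columns, so the support is padded
    to size \<open>s\<close>; the bound by \<open>CARD('n)\<close> makes room for this.\<close>
  obtain T where T: "supp d \<subseteq> T" "card T = s"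
    using exists_subset_between[of "supp d" s UNIV] assms by auto
  have inj: "inj_on (\<lambda>j. column j A) T" and ind: "independent ((\<lambda>j. column j A) ` T)"
    using reg T unfolding s_regular_def by auto
  define g where "g = inv_into T (\<lambda>j. column j A)"
  have g: "g (column j A) = j" if "j \<in> T" for j
    unfolding g_def using inv_into_f_f[OF inj that] .
  have "0 = (\<Sum>j\<in>UNIV. (d $ j) *\<^sub>R column j A)"
    using assms(4) by (simp add: matrix_mult_sum scalar_mult_eq_scaleR)
  also have "\<dots> = (\<Sum>j\<in>T. (d $ j) *\<^sub>R column j A)"
    using T by (intro sum.mono_neutral_right) (auto simp: supp_def)
  also have "\<dots> = (\<Sum>v\<in>(\<lambda>j. column j A) ` T. (d $ g v) *\<^sub>R v)"
    unfolding sum.reindex[OF inj] by (rule sum.cong) (simp_all add: g)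
  finally have sum0: "(\<Sum>v\<in>(\<lambda>j. column j A) ` T. (d $ g v) *\<^sub>R v) = 0" ..
  have "d $ j = 0" if "j \<in> T" for j
  proof -
    have "d $ g (column j A) = 0"
      using independentD[OF ind _ subset_refl sum0] that by simp
    then show ?thesis using g that by simp
  qed
  then show ?thesis
    using T by (auto simp: vec_eq_iff supp_def)
qed

lemma supp_diff: "supp (x - y) \<subseteq> supp x \<union> supp y"
  by (auto simp: supp_def)

text \<open>On a coordinate subspace of dimension at most \<open>s\<close> the matrix is injective,
  so the norm of \<open>A *v x\<close> dominates a positive multiple of the norm of
  \<open>x\<close>. Finitely many such subspaces cover the feasible set.\<close>

lemma bounded_feasible_sublevel:
  fixes A :: "real ^ 'n ^ 'm"
  assumes reg: "s_regular s A" "s \<le> CARD('n)"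
  shows "bounded {x \<in> feasible s. objective A b x \<le> C}"
proof -
  define K where "K T = {x. supp x \<subseteq> T \<and> objective A b x \<le> C}" for T :: "'n set"
  have "bounded (K T)" if "card T \<le> s" for T
  proof -
    define V where "V = {x::real^'n. supp x \<subseteq> T}"
    have V: "subspace V"
    proof -
      have "V = {x. \<forall>i. i \<notin> T \<longrightarrow> x $ i = 0}"
        by (auto simp: V_def supp_def)
      then show ?thesis by (simp add: subspace_def)
    qed
    have "\<exists>e>0. \<forall>x\<in>V. e * norm x \<le> norm (A *v x)"
    proof (rule injective_imp_isometric)
      show "closed V" by (rule closed_subspace[OF V])
      show "\<forall>x\<in>V. A *v x = 0 \<longrightarrow> x = 0"
        using s_regular_injective[OF reg] that card_mono[of T]
        by (metis V_def finite mem_Collect_eq order_trans)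
    qed (use V in auto)
    then obtain e where e: "e > 0" "\<And>x. x \<in> V \<Longrightarrow> e * norm x \<le> norm (A *v x)" by blast
    have "norm x \<le> (sqrt (2 * C) + norm b) / e" if "x \<in> K T" for x
    proof -
      have "(norm (A *v x - b))\<^sup>2 \<le> 2 * C"
        using that by (simp add: K_def objective_def)
      then have "norm (A *v x - b) \<le> sqrt (2 * C)"
        using real_le_rsqrt by blast
      moreover have "norm (A *v x) \<le> norm (A *v x - b) + norm b"
        using norm_triangle_sub[of "A *v x" b] by simp
      ultimately show ?thesis
        using e(2)[of x] that e(1) by (simp add: K_def V_def field_simps)
    qed
    then show ?thesis by (meson boundedI)
  qed
  then have "bounded (\<Union>T\<in>{T. card T \<le> s}. K T)"
    by (intro bounded_UN) auto
  then show ?thesis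
    by (rule bounded_subset) (auto simp: K_def feasible_def sparse_set_def)
qed

section \<open>The quadratic objective\<close>

lemma objective_expand:
  fixes A :: "real ^ 'n ^ 'm"
  shows "objective A b y = objective A b x + grad (objective A b) x \<bullet> (y - x)
      + 1/2 * (norm (A *v (y - x)))\<^sup>2"
proof -
  have eq: "A *v y - b = (A *v x - b) + A *v (y - x)"
    by (simp add: matrix_vector_mult_diff_distrib)
  have "(transpose A *v (A *v x - b)) \<bullet> (y - x) = (A *v x - b) \<bullet> (A *v (y - x))"
    by (metis dot_lmul_matrix transpose_matrix_vector)
  then show ?thesis
    unfolding objective_def grad_objective eq
    by (simp add: power2_norm_eq_inner inner_add_left inner_add_right inner_commute algebra_simps)
qed

lemma objective_convex:
  "objective A b x + grad (objective A b) x \<bullet> (y - x) \<le> objective A b y"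
  using objective_expand[of A b y x] by simp

section \<open>Projection onto sparse nonnegative vectors\<close>

lemma projD:
  assumes "y \<in> proj \<Omega> v"
  shows "y \<in> \<Omega>" and "z \<in> \<Omega> \<Longrightarrow> dist v y \<le> dist v z"
  using assms unfolding proj_def is_arg_min_def by (auto simp: not_less)

text \<open>Squared distances split over coordinates, and those on which both points agree cancel.
  This reduces the exchange arguments below to one or two coordinates.\<close>

lemma proj_sum_le:
  fixes v :: "real ^ 'n"
  assumes y: "y \<in> proj \<Omega> v" and z: "z \<in> \<Omega>" and eq: "\<And>k. k \<notin> D \<Longrightarrow> z $ k = y $ k"
  shows "(\<Sum>k\<in>D. (v $ k - y $ k)\<^sup>2) \<le> (\<Sum>k\<in>D. (v $ k - z $ k)\<^sup>2)"
proof -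
  have split: "(norm (v - u))\<^sup>2 = (\<Sum>k\<in>D. (v $ k - u $ k)\<^sup>2) + (\<Sum>k\<in>-D. (v $ k - u $ k)\<^sup>2)"
    for u :: "real ^ 'n"
  proof -
    have "(norm (v - u))\<^sup>2 = (\<Sum>k\<in>UNIV. (v $ k - u $ k)\<^sup>2)"
      unfolding power2_norm_eq_inner inner_vec_def by (simp add: power2_eq_square)
    then show ?thesis
      using sum.union_disjoint[of D "-D" "\<lambda>k. (v $ k - u $ k)\<^sup>2"] by (simp add: Compl_partition)
  qed
  have "(norm (v - y))\<^sup>2 \<le> (norm (v - z))\<^sup>2"
    using projD(2)[OF y z] by (simp add: dist_norm)
  moreover have "(\<Sum>k\<in>-D. (v $ k - z $ k)\<^sup>2) = (\<Sum>k\<in>-D. (v $ k - y $ k)\<^sup>2)"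
    using eq by simp
  ultimately show ?thesis unfolding split by simp
qed

text \<open>Resetting a selected coordinate to the positive part of \<open>v $ i\<close> stays
  feasible, so it cannot be strictly closer to \<open>v\<close>. A negative \<open>v $ i\<close> is
  impossible, as 0 would then beat the positive \<open>y $ i\<close>.\<close>

lemma proj_feasible_supp:
  fixes v :: "real ^ 'n"
  assumes y: "y \<in> proj (feasible s) v" and i: "y $ i \<noteq> 0"
  shows "y $ i = v $ i"
proof -
  define z :: "real^'n" where "z = (\<chi> k. if k = i then max 0 (v $ i) else y $ k)"
  have yf: "card (supp y) \<le> s" "\<And>k. 0 \<le> y $ k"
    using projD(1)[OF y] by (auto simp: feasible_def sparse_set_def nonneg_orthant_def)
  have "supp z \<subseteq> supp y" using i by (auto simp: z_def supp_def)
  then have "z \<in> feasible s"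
    using yf card_mono[of "supp y" "supp z"]
    by (auto simp: feasible_def sparse_set_def nonneg_orthant_def z_def)
  from proj_sum_le[OF y this, of "{i}"]
  have le: "(v $ i - y $ i)\<^sup>2 \<le> (v $ i - max 0 (v $ i))\<^sup>2"
    by (auto simp: z_def)
  show ?thesis
  proof (cases "v $ i \<ge> 0")
    case True
    then show ?thesis using le by simp
  next
    case False
    moreover have "y $ i > 0" using yf(2)[of i] i by simp
    ultimately have "v $ i * y $ i < 0" "0 < (y $ i)\<^sup>2" "max 0 (v $ i) = 0"
      by (auto simp: mult_neg_pos)
    moreover from this have "(y $ i)\<^sup>2 \<le> 2 * (v $ i * y $ i)"
      using le by (simp add: power2_diff mult.assoc)
    ultimately show ?thesis by linarith
  qed
qed

text \<open>With fewer than \<open>s\<close> entries in use, filling in \<open>v $ i\<close> would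
  be strictly closer. With all in use, exchanging \<open>j\<close> for \<open>i\<close> must not be
  an improvement, and \<open>y $ j\<close> equals \<open>v $ j\<close> by
  \<open>proj_feasible_supp\<close>.\<close>

lemma proj_feasible_unselected:
  fixes v :: "real ^ 'n"
  assumes y: "y \<in> proj (feasible s) v" and i: "y $ i = 0" and vi: "0 < v $ i"
  shows "card (supp y) = s" and "y $ j \<noteq> 0 \<Longrightarrow> v $ i \<le> y $ j"
proof -
  have yf: "card (supp y) \<le> s" "\<And>k. 0 \<le> y $ k"
    using projD(1)[OF y] by (auto simp: feasible_def sparse_set_def nonneg_orthant_def)
  show "card (supp y) = s"
  proof (rule ccontr)
    assume "card (supp y) \<noteq> s"
    then have lt: "card (supp y) < s" using yf by simp
    define z :: "real^'n" where "z = (\<chi> k. if k = i then v $ i else y $ k)"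
    have "supp z \<subseteq> insert i (supp y)" by (auto simp: z_def supp_def)
    then have "card (supp z) \<le> Suc (card (supp y))"
      using card_mono[of "insert i (supp y)" "supp z"] by (auto simp: card_insert_if split: if_splits)
    then have "z \<in> feasible s"
      using yf lt vi by (auto simp: feasible_def sparse_set_def nonneg_orthant_def z_def)
    from proj_sum_le[OF y this, of "{i}"] show False
      using i vi by (auto simp: z_def)
  qed
  assume j: "y $ j \<noteq> 0"
  show "v $ i \<le> y $ j"
  proof (rule ccontr)
    assume "\<not> v $ i \<le> y $ j"
    then have lt: "y $ j < v $ i" by simp
    have ij: "i \<noteq> j" using i j by auto
    define z :: "real^'n" where "z = (\<chi> k. if k = i then v $ i else if k = j then 0 else y $ k)"
    have "supp z \<subseteq> insert i (supp y - {j})" by (auto simp: z_def supp_def)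
    then have "card (supp z) \<le> card (insert i (supp y - {j}))" by (simp add: card_mono)
    also have "\<dots> = card (supp y)"
      using i j card.remove[of "supp y" j] by (simp add: supp_def)
    finally have "z \<in> feasible s"
      using yf vi by (auto simp: feasible_def sparse_set_def nonneg_orthant_def z_def)
    from proj_sum_le[OF y this, of "{i,j}"]
    have "(v $ i - y $ i)\<^sup>2 + (v $ j - y $ j)\<^sup>2 \<le> (v $ j)\<^sup>2"
      using ij by (auto simp: z_def)
    then have "(v $ i)\<^sup>2 \<le> (y $ j)\<^sup>2"
      using i proj_feasible_supp[OF y j] by simp
    then show False using lt yf(2)[of j] vi by (simp add: power2_le_iff_abs_le)
  qed
qed

text \<open>As the set may be nonconvex, the variational inequality of convex projections is
  replaced by comparing \<open>y\<close> with the competitor \<open>x\<close>. This bounds the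
  linear term of the expansion; the quadratic one is bounded through
  \<open>lipschitz_const A\<close>.\<close>

lemma projected_gradient_decrease:
  fixes A :: "real ^ 'n ^ 'm"
  assumes y: "y \<in> proj \<Omega> (x - a *\<^sub>R grad (objective A b) x)" and x: "x \<in> \<Omega>" and a: "0 < a"
  shows "objective A b y \<le> objective A b x - (1 / a - lipschitz_const A) / 2 * (norm (y - x))\<^sup>2"
proof -
  define g where "g = grad (objective A b) x"
  have "(norm (x - a *\<^sub>R g - y))\<^sup>2 \<le> (norm (x - a *\<^sub>R g - x))\<^sup>2"
    using projD(2)[OF y x] by (simp add: dist_norm g_def)
  then have "(norm (y - x))\<^sup>2 + 2 * a * (g \<bullet> (y - x)) \<le> 0"
    by (simp add: power2_norm_eq_inner inner_diff_left inner_diff_right inner_commute algebra_simps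
        power2_eq_square[of a])
  then have "g \<bullet> (y - x) \<le> - (1 / a) / 2 * (norm (y - x))\<^sup>2"
    using a by (simp add: field_simps)
  then show ?thesis
    using objective_expand[of A b y x] norm_le_lipschitz_const[of A "y - x"]
    by (simp add: g_def algebra_simps diff_divide_distrib)
qed

section \<open>Convergence from finitely many limit points\<close>

text \<open>Around an isolated limit point, an annulus free of limit points contains only finitely
  many terms. Once the steps are shorter than its width, the sequence cannot jump across it and
  stays inside.\<close>

lemma convergent_finite_limit_points:
  fixes x :: "nat \<Rightarrow> 'a::euclidean_space"
  assumes bd: "bounded (range x)" and step: "(\<lambda>k. x (Suc k) - x k) \<longlonglongrightarrow> 0"
    and fin: "finite F" and lim: "\<And>f l. strict_mono f \<Longrightarrow> (x \<circ> f) \<longlonglongrightarrow> l \<Longrightarrow> l \<in> F"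
  shows "\<exists>p\<in>F. x \<longlonglongrightarrow> p"
proof -
  obtain p f where f: "strict_mono f" "(x \<circ> f) \<longlonglongrightarrow> p"
    using bounded_imp_convergent_subsequence[OF bd] by blast
  have "p \<in> F" using lim f by blast
  \<comment> \<open>The inequality is strict so that even the closed ball of radius \<open>e\<close>
    around \<open>p\<close> contains no other point of \<open>F\<close>: limits only inherit weak
    bounds.\<close>
  obtain e where e: "e > 0" "\<And>q. q \<in> F \<Longrightarrow> q \<noteq> p \<Longrightarrow> e < dist p q"
    using finite_set_avoid[OF fin, of p]
    by (metis dense dual_order.strict_trans1 )
  have "\<forall>\<^sub>F k in sequentially. dist (x k) p < d" if d: "0 < d" "d \<le> e" for d
  proof -
    have "finite {k. d / 2 \<le> dist (x k) p \<and> dist (x k) p \<le> d}" (is "finite ?B")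
    proof (rule ccontr)
      assume inf: "infinite ?B"
      define h where "h = enumerate ?B"
      have h: "strict_mono h" "\<And>n. h n \<in> ?B"
        using inf strict_mono_enumerate enumerate_in_set unfolding h_def by blast+
      have "bounded (range (x \<circ> h))"
        using bd by (rule bounded_subset) auto
      then obtain l g where g: "strict_mono g" "((x \<circ> h) \<circ> g) \<longlonglongrightarrow> l"
        using bounded_imp_convergent_subsequence by blast
      then have "l \<in> F"
        using lim[of "h \<circ> g" l] h(1) by (simp add: strict_mono_o o_assoc)
      have dl: "(\<lambda>n. dist (((x \<circ> h) \<circ> g) n) p) \<longlonglongrightarrow> dist l p"
        using g by (intro tendsto_intros)
      have "d / 2 \<le> dist l p"
        by (rule tendsto_lowerbound[OF dl]) (use h in auto)
      moreover have "dist l p \<le> d"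
        by (rule tendsto_upperbound[OF dl]) (use h in auto)
      moreover have "l = p"
        using e(2)[OF \<open>l \<in> F\<close>] d \<open>dist l p \<le> d\<close> by (force simp: dist_commute)
      ultimately show False using d by simp
    qed
    then obtain N1 where N1: "\<And>k. k \<ge> N1 \<Longrightarrow> k \<notin> ?B"
      by (metis finite_nat_set_iff_bounded leD)
    obtain N2 where N2: "\<And>k. k \<ge> N2 \<Longrightarrow> norm (x (Suc k) - x k) < d / 2"
      using LIMSEQ_D[OF step, of "d / 2"] d by auto
    obtain N3 where N3: "\<And>n. n \<ge> N3 \<Longrightarrow> dist (x (f n)) p < d / 2"
      using metric_LIMSEQ_D[OF f(2), of "d / 2"] d by auto
    define n where "n = f (max N3 (max N1 N2))"
    have n: "n \<ge> N1" "n \<ge> N2" "dist (x n) p < d / 2"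
      using seq_suble[OF f(1), of "max N3 (max N1 N2)"] N3[of "max N3 (max N1 N2)"]
      unfolding n_def by auto
    have "dist (x k) p < d / 2" if "k \<ge> n" for k
      using that
    proof (induction k rule: dec_induct)
      case base
      then show ?case by (rule n)
    next
      case (step k)
      have "dist (x (Suc k)) p \<le> dist (x (Suc k)) (x k) + dist (x k) p"
        by (rule dist_triangle)
      then have "dist (x (Suc k)) p < d"
        using step N2[of k] n by (simp add: dist_norm)
      then show ?case
        using N1[of "Suc k"] step n by auto
    qed
    then show ?thesis
      unfolding eventually_sequentially using d by (intro exI[of _ n]) fastforce
  qed
  then have "\<forall>\<^sub>F k in sequentially. dist (x k) p < d" if "0 < d" for d
    using that e(1)
    by (cases "d \<le> e") (force elim: eventually_mono)+
  then have "x \<longlonglongrightarrow> p"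
    by (simp add: tendsto_iff)
  then show ?thesis using \<open>p \<in> F\<close> by blast
qed

section \<open>Support-stationary points and local minimality\<close>

text \<open>There are finitely many supports, and each carries at most one such point: for two of
  them with difference \<open>d\<close>, pairing \<open>d\<close> with the difference of gradients
  gives both 0 and the squared norm of \<open>A *v d\<close>.\<close>

lemma finite_support_stationary:
  fixes A :: "real ^ 'n ^ 'm"
  assumes reg: "s_regular s A" "s \<le> CARD('n)"
  shows "finite {z. card (supp z) \<le> s \<and> (\<forall>i\<in>supp z. grad (objective A b) z $ i = 0)}"
    (is "finite ?F")
proof -
  have "inj_on supp ?F"
  proof (rule inj_onI)
    fix z w assume zw: "z \<in> ?F" "w \<in> ?F" "supp z = supp w"
    define d where "d = z - w"
    have ds: "supp d \<subseteq> supp z" using supp_diff[of z w] zw by (simp add: d_def)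
    have "d \<bullet> (grad (objective A b) z - grad (objective A b) w) = 0"
      unfolding inner_vec_def
    proof (intro sum.neutral ballI)
      fix i
      show "d $ i \<bullet> (grad (objective A b) z - grad (objective A b) w) $ i = 0"
      proof (cases "i \<in> supp z")
        case True
        then have "grad (objective A b) z $ i = 0" "grad (objective A b) w $ i = 0"
          using zw by auto
        then show ?thesis by simp
      next
        case False
        then have "d $ i = 0" using ds by (auto simp: supp_def)
        then show ?thesis by simp
      qed
    qed
    then have "(norm (A *v d))\<^sup>2 = 0"
      unfolding norm_matrix_vector_eq
      by (simp add: grad_objective d_def matrix_vector_mult_diff_distrib matrix_vector_mul_assoc)
    then have "A *v d = 0" by simp
    moreover have "card (supp d) \<le> s"
      using card_mono[OF _ ds] zw by auto
    ultimately show "z = w"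
      using s_regular_injective[OF reg, of d] by (simp add: d_def)
  qed
  then show ?thesis
    using finite_imageD finite by blast
qed

text \<open>A feasible point near \<open>p\<close> keeps every nonzero coordinate of
  \<open>p\<close>. If \<open>p\<close> already has \<open>s\<close> of them, no new one can appear;
  otherwise new ones only grow from 0, where the gradient is nonnegative. Convexity then
  concludes.\<close>

lemma local_minimizer_objective:
  fixes A :: "real ^ 'n ^ 'm"
  assumes p: "p \<in> feasible s" and stat: "\<And>i. i \<in> supp p \<Longrightarrow> grad (objective A b) p $ i = 0"
    and nonneg: "\<And>i. card (supp p) < s \<Longrightarrow> i \<notin> supp p \<Longrightarrow> 0 \<le> grad (objective A b) p $ i"
  shows "local_minimizer (objective A b) (feasible s) p"
proof -
  define g where "g = grad (objective A b) p"
  have pcard: "card (supp p) \<le> s"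
    using p by (simp add: feasible_def sparse_set_def)
  \<comment> \<open>Inserting 1 keeps the minimum defined when \<open>p\<close> is zero.\<close>
  define e where "e = Min (insert 1 ((\<lambda>i. \<bar>p $ i\<bar>) ` supp p))"
  have e: "0 < e" "\<And>i. i \<in> supp p \<Longrightarrow> e \<le> \<bar>p $ i\<bar>"
    unfolding e_def by (auto simp: supp_def)
  have "objective A b p \<le> objective A b y" if y: "y \<in> feasible s" "y \<in> ball p e" for y
  proof -
    have sub: "supp p \<subseteq> supp y"
    proof
      fix i assume i: "i \<in> supp p"
      have "\<bar>p $ i - y $ i\<bar> \<le> norm (p - y)"
        using component_le_norm_cart[of "p - y" i] by simp
      then show "i \<in> supp y"
        using e(2)[OF i] y(2) by (auto simp: supp_def dist_norm)
    qed
    have "0 \<le> g $ i * (y - p) $ i" for i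
    proof (cases "i \<in> supp p")
      case True
      then show ?thesis using stat by (simp add: g_def)
    next
      case False
      show ?thesis
      proof (cases "card (supp p) < s")
        case True
        then show ?thesis
          using nonneg[OF True False] False y(1)
          by (simp add: g_def supp_def feasible_def nonneg_orthant_def)
      next
        case full: False
        have "card (supp y) \<le> card (supp p)"
          using y(1) full by (simp add: feasible_def sparse_set_def)
        then have "supp y = supp p"
          using card_seteq[OF _ sub] by simp
        then have "(y - p) $ i = 0"
          using False unfolding supp_def by auto
        then show ?thesis by simp
      qed
    qed
    then have "0 \<le> g \<bullet> (y - p)"
      by (simp add: inner_vec_def sum_nonneg)
    then show ?thesis
      using objective_convex[of A b p y] by (simp add: g_def)
  qed
  then show ?thesis
    unfolding local_minimizer_def using p e(1) by auto
qed

theorem theorem4p2: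
  fixes A :: "real ^ 'n ^ 'm" and b :: "real ^ 'm" and s :: nat
    and \<alpha>\<^sub>0 \<sigma> \<beta> :: real and x :: "nat \<Rightarrow> real ^ 'n"
  assumes "0 < s" and "s < CARD('m)" and "CARD('m) < CARD('n)"
    and "s_regular s A"
    and "gspa_sequence A b s \<alpha>\<^sub>0 \<sigma> \<beta> x"
  shows "\<exists>x'. x \<longlonglongrightarrow> x' \<and> local_minimizer (objective A b) (feasible s) x'"
proof -
  define r where "r = objective A b"
  define G where "G k = grad r (x k)" for k
  define L where "L = lipschitz_const A"
  define D where "D k = x (Suc k) - x k" for k
  have sN: "s \<le> CARD('n)" using assms(2,3) by simp
  note inj = s_regular_injective[OF assms(4) sN]
  from assms(5) obtain \<Gamma> where \<alpha>0: "0 < \<alpha>\<^sub>0" "\<alpha>\<^sub>0 < 1 / L" and \<sigma>: "0 < \<sigma>" and \<beta>: "0 < \<beta>" "\<beta> < 1"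
    and x0: "x 0 = 0"
    and step: "\<And>k. gspa_step (feasible s) r \<alpha>\<^sub>0 \<sigma> \<beta> (x k) (\<Gamma> k) (x (Suc k)) (\<Gamma> (Suc k))"
    unfolding gspa_sequence_def L_def r_def by blast
  \<comment> \<open>The two entries are the decrease coefficients of a line search step and of a
    step of size \<open>\<alpha>\<^sub>0\<close>, the latter rescaled because the common estimate
    divides by the squared stepsize.\<close>
  define c where "c = min (\<sigma> / 2) (\<alpha>\<^sub>0\<^sup>2 * (1 / \<alpha>\<^sub>0 - L) / 2)"
  have "L < 1 / \<alpha>\<^sub>0"
  proof -
    \<comment> \<open>Division by zero yields 0, so the bounds on \<open>\<alpha>\<^sub>0\<close>
      exclude \<open>L = 0\<close> as well as a negative \<open>L\<close>.\<close>
    have "L > 0" using \<alpha>0 by (metis less_trans zero_less_divide_1_iff)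
    then show ?thesis using \<alpha>0 by (simp add: field_simps)
  qed
  then have c: "c > 0" unfolding c_def using \<sigma> \<alpha>0 by simp

  \<comment> \<open>A decrease estimate common to both kinds of step\<close>
  have feas0: "x 0 \<in> feasible s"
    by (simp add: x0 feasible_def sparse_set_def nonneg_orthant_def supp_def)
  \<comment> \<open>Feasibility of \<open>x k\<close> is a premise because it serves as a competitor
    of the projection; the induction for \<open>feas\<close> uses this claim in turn.\<close>
  have stepsize: "\<exists>a. 0 < a \<and> a \<le> \<alpha>\<^sub>0 \<and> x (Suc k) \<in> proj (feasible s) (x k - a *\<^sub>R G k) \<and>
      r (x (Suc k)) \<le> r (x k) - c * ((norm (D k))\<^sup>2 / a\<^sup>2)" if xk: "x k \<in> feasible s" for k
  proof -
    from step[of k] obtain xt where xt: "xt \<in> proj (feasible s) (x k - \<alpha>\<^sub>0 *\<^sub>R G k)"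
      and cases: "if supp xt = \<Gamma> k then x (Suc k) = xt else \<exists>X m.
          (\<forall>\<alpha>>0. X \<alpha> \<in> proj (feasible s) (x k - \<alpha> *\<^sub>R G k)) \<and>
          is_arg_min id
            (\<lambda>m::nat. m > 0 \<and> sufficient_decrease r \<sigma> (x k) (\<alpha>\<^sub>0 * \<beta> ^ m) (X (\<alpha>\<^sub>0 * \<beta> ^ m))) m \<and>
          x (Suc k) = X (\<alpha>\<^sub>0 * \<beta> ^ m)"
      unfolding gspa_step_def G_def by blast
    show ?thesis
    proof (cases "supp xt = \<Gamma> k")
      case True
      then have P: "x (Suc k) \<in> proj (feasible s) (x k - \<alpha>\<^sub>0 *\<^sub>R G k)"
        using xt cases by simp
      have "r (x (Suc k)) \<le> r (x k) - (1 / \<alpha>\<^sub>0 - L) / 2 * (norm (D k))\<^sup>2"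
        using projected_gradient_decrease[OF P[unfolded G_def r_def] xk \<alpha>0(1)]
        by (simp add: r_def L_def D_def)
      moreover have "c * ((norm (D k))\<^sup>2 / \<alpha>\<^sub>0\<^sup>2) \<le> (1 / \<alpha>\<^sub>0 - L) / 2 * (norm (D k))\<^sup>2"
      proof -
        have "c / \<alpha>\<^sub>0\<^sup>2 \<le> (1 / \<alpha>\<^sub>0 - L) / 2"
          using \<alpha>0(1) min.cobounded2[of "\<sigma> / 2" "\<alpha>\<^sub>0\<^sup>2 * (1 / \<alpha>\<^sub>0 - L) / 2"]
          unfolding c_def[symmetric] by (simp add: pos_divide_le_eq mult.commute)
        from mult_right_mono[OF this, of "(norm (D k))\<^sup>2"] show ?thesis by simp
      qed
      ultimately have "r (x (Suc k)) \<le> r (x k) - c * ((norm (D k))\<^sup>2 / \<alpha>\<^sub>0\<^sup>2)"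
        by linarith
      then show ?thesis using P \<alpha>0(1) by blast
    next
      case False
      then obtain X m where X: "\<forall>\<alpha>>0. X \<alpha> \<in> proj (feasible s) (x k - \<alpha> *\<^sub>R G k)"
        and m: "sufficient_decrease r \<sigma> (x k) (\<alpha>\<^sub>0 * \<beta> ^ m) (X (\<alpha>\<^sub>0 * \<beta> ^ m))"
        and xS: "x (Suc k) = X (\<alpha>\<^sub>0 * \<beta> ^ m)"
        using cases unfolding is_arg_min_def by auto
      define a where "a = \<alpha>\<^sub>0 * \<beta> ^ m"
      have a: "0 < a" "a \<le> \<alpha>\<^sub>0"
        using \<alpha>0(1) \<beta> by (auto simp: a_def power_le_one)
      have "r (x (Suc k)) \<le> r (x k) - \<sigma> / 2 * ((norm (D k))\<^sup>2 / a\<^sup>2)"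
        using m by (simp add: sufficient_decrease_def xS D_def a_def)
      moreover have "c * ((norm (D k))\<^sup>2 / a\<^sup>2) \<le> \<sigma> / 2 * ((norm (D k))\<^sup>2 / a\<^sup>2)"
        by (rule mult_right_mono) (simp_all only: c_def min.cobounded1 zero_le_divide_iff zero_le_power2 simp_thms)
      ultimately show ?thesis
        using X a xS by (intro exI[of _ a]) (auto simp: a_def)
    qed
  qed
  have feas: "x k \<in> feasible s" for k
  proof (induction k)
    case (Suc k)
    then show ?case using stepsize[OF Suc] projD(1) by blast
  qed (rule feas0)
  then obtain a where a: "\<And>k. 0 < a k" "\<And>k. a k \<le> \<alpha>\<^sub>0"
    and proj: "\<And>k. x (Suc k) \<in> proj (feasible s) (x k - a k *\<^sub>R G k)"
    and dec: "\<And>k. r (x (Suc k)) \<le> r (x k) - c * ((norm (D k))\<^sup>2 / (a k)\<^sup>2)"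
    using stepsize by metis
  have xcard: "card (supp (x k)) \<le> s" and xpos: "0 \<le> x k $ i" for k i
    using feas[of k] by (auto simp: feasible_def sparse_set_def nonneg_orthant_def)
  have G_supp: "a k * G k $ i = - D k $ i" if "i \<in> supp (x (Suc k))" for k i
    using proj_feasible_supp[OF proj, of k i] that by (simp add: supp_def D_def)

  \<comment> \<open>Vanishing increments and boundedness\<close>
  have rdec: "decseq (\<lambda>k. r (x k))"
  proof (rule decseq_SucI)
    fix k
    have "0 \<le> c * ((norm (D k))\<^sup>2 / (a k)\<^sup>2)" using c by simp
    then show "r (x (Suc k)) \<le> r (x k)" using dec[of k] by linarith
  qed
  have r0: "0 \<le> r z" for z by (simp add: r_def objective_def)
  \<comment> \<open>The values of \<open>r\<close> decrease and are bounded below, so their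
    consecutive differences tend to 0, and these dominate \<open>c\<close> times the squared
    ratio.\<close>
  have ratio: "(\<lambda>k. norm (D k) / a k) \<longlonglongrightarrow> 0"
  proof -
    obtain l where l: "(\<lambda>k. r (x k)) \<longlonglongrightarrow> l"
      using decseq_convergent[OF rdec, of 0] r0 by blast
    have "(\<lambda>k. (r (x k) - r (x (Suc k))) / c) \<longlonglongrightarrow> (l - l) / c"
      using l c by (intro tendsto_intros LIMSEQ_Suc) auto
    then have lim: "(\<lambda>k. (r (x k) - r (x (Suc k))) / c) \<longlonglongrightarrow> 0" by simp
    have "(\<lambda>k. (norm (D k) / a k)\<^sup>2) \<longlonglongrightarrow> 0"
    proof (rule tendsto_sandwich[OF _ _ tendsto_const lim])
      show "\<forall>\<^sub>F k in sequentially. (norm (D k) / a k)\<^sup>2 \<le> (r (x k) - r (x (Suc k))) / c"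
        using dec c by (intro always_eventually allI) (simp add: field_simps power_divide)
    qed simp
    then show ?thesis by (simp add: power_tendsto_0_iff)
  qed
  have D0: "D \<longlonglongrightarrow> 0"
  proof (rule Lim_null_comparison)
    show "(\<lambda>k. \<alpha>\<^sub>0 * (norm (D k) / a k)) \<longlonglongrightarrow> 0"
      using tendsto_mult_right_zero[OF ratio] by simp
    show "\<forall>\<^sub>F k in sequentially. norm (D k) \<le> \<alpha>\<^sub>0 * (norm (D k) / a k)"
    proof (intro always_eventually allI)
      fix k
      show "norm (D k) \<le> \<alpha>\<^sub>0 * (norm (D k) / a k)"
        using a(1)[of k] mult_right_mono[OF a(2)[of k] norm_ge_zero[of "D k"]]
        by (simp add: field_simps)
    qed
  qed
  have bd: "bounded (range x)"
  proof (rule bounded_subset[OF bounded_feasible_sublevel[OF assms(4) sN, of b "r (x 0)"]])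
    show "range x \<subseteq> {z \<in> feasible s. objective A b z \<le> r (x 0)}"
      using feas decseqD[OF rdec, of 0] by (auto simp: r_def)
  qed

  have G_cont: "(\<lambda>n. G (f n) $ i) \<longlonglongrightarrow> grad r q $ i"
    if "(\<lambda>n. x (f n)) \<longlonglongrightarrow> q" for f :: "nat \<Rightarrow> nat" and q i
    unfolding G_def r_def grad_objective
    by (intro tendsto_intros bounded_linear.tendsto[OF matrix_vector_mul_bounded_linear] that)

  \<comment> \<open>Convergence to a support-stationary point\<close>
  define F where "F = {z. card (supp z) \<le> s \<and> (\<forall>i\<in>supp z. grad r z $ i = 0)}"
  have "\<exists>p\<in>F. x \<longlonglongrightarrow> p"
  proof (rule convergent_finite_limit_points[OF bd])
    show "(\<lambda>k. x (Suc k) - x k) \<longlonglongrightarrow> 0" using D0 by (simp add: D_def[abs_def])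
    show "finite F"
      unfolding F_def r_def by (rule finite_support_stationary[OF assms(4) sN])
  next
    fix f l assume f: "strict_mono (f :: nat \<Rightarrow> nat)" "(x \<circ> f) \<longlonglongrightarrow> l"
    then have lim: "(\<lambda>n. x (f n)) \<longlonglongrightarrow> l" by (simp add: o_def)
    \<comment> \<open>\<open>G_supp\<close> combines the gradient at \<open>x k\<close> with the
      support of \<open>x (Suc k)\<close>, so both subsequences must share the limit
      \<open>l\<close>.\<close>
    have "(\<lambda>n. D (f n) + x (f n)) \<longlonglongrightarrow> 0 + l"
      using LIMSEQ_subseq_LIMSEQ[OF D0 f(1)] lim by (intro tendsto_add) (simp_all add: o_def)
    then have limS: "(\<lambda>n. x (Suc (f n))) \<longlonglongrightarrow> l" by (simp add: D_def)
    have ev: "\<forall>\<^sub>F n in sequentially. i \<in> supp (x (Suc (f n)))" if "i \<in> supp l" for i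
      using tendsto_imp_eventually_ne[OF tendsto_vec_nth[OF limS, of i], of 0] that
      by (simp add: supp_def)
    have "grad r l $ i = 0" if i: "i \<in> supp l" for i
    proof -
      have "(\<lambda>n. G (f n) $ i) \<longlonglongrightarrow> 0"
      proof (rule Lim_null_comparison)
        show "(\<lambda>n. norm (D (f n)) / a (f n)) \<longlonglongrightarrow> 0"
          using LIMSEQ_subseq_LIMSEQ[OF ratio f(1)] by (simp add: o_def)
        show "\<forall>\<^sub>F n in sequentially. norm (G (f n) $ i) \<le> norm (D (f n)) / a (f n)"
          using ev[OF i]
        proof eventually_elim
          case (elim n)
          have "a (f n) * \<bar>G (f n) $ i\<bar> = \<bar>D (f n) $ i\<bar>"
            using G_supp[OF elim] a(1)[of "f n"]
            by (metis abs_minus_cancel abs_mult abs_of_pos)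
          also have "\<dots> \<le> norm (D (f n))" by (rule component_le_norm_cart)
          finally show ?case using a(1)[of "f n"] by (simp add: field_simps)
        qed
      qed
      then show ?thesis using G_cont[OF lim] LIMSEQ_unique by blast
    qed
    moreover have "card (supp l) \<le> s"
    proof -
      have "\<forall>\<^sub>F n in sequentially. \<forall>i\<in>supp l. i \<in> supp (x (Suc (f n)))"
        using ev by (intro eventually_ball_finite) auto
      then obtain n where "supp l \<subseteq> supp (x (Suc (f n)))"
        using eventually_happens by force
      then show ?thesis
        using card_mono[of "supp (x (Suc (f n)))"] xcard[of "Suc (f n)"] by (metis finite le_trans)
    qed
    ultimately show "l \<in> F" by (simp add: F_def)
  qed
  then obtain p where pF: "p \<in> F" and lim: "x \<longlonglongrightarrow> p" by blast
  have comp: "(\<lambda>k. x k $ j) \<longlonglongrightarrow> p $ j" for j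
    using lim by (rule tendsto_vec_nth)
  have pfeas: "p \<in> feasible s"
    using pF xpos LIMSEQ_le_const[OF comp]
    by (auto simp: F_def feasible_def sparse_set_def nonneg_orthant_def)

  \<comment> \<open>Sign of the gradient off the support of the limit\<close>
  have "0 \<le> grad r p $ i" if small: "card (supp p) < s" and i: "i \<notin> supp p" for i
  proof (rule ccontr)
    assume "\<not> 0 \<le> grad r p $ i"
    define \<delta> where "\<delta> = - grad r p $ i / 2"
    have \<delta>: "\<delta> > 0" "grad r p $ i < - \<delta>"
      using \<open>\<not> 0 \<le> grad r p $ i\<close> by (auto simp: \<delta>_def)
    have evG: "\<forall>\<^sub>F k in sequentially. G k $ i < - \<delta>"
      using order_tendstoD(2)[OF G_cont[OF lim, of i] \<delta>(2)] .
    have evD: "\<forall>\<^sub>F k in sequentially. norm (D k) < a k * \<delta>"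
      using order_tendstoD(2)[OF ratio \<delta>(1)]
      by eventually_elim (use a(1) in \<open>simp add: field_simps\<close>)
    \<comment> \<open>If \<open>i\<close> were selected, its coordinate would move by more than
      \<open>a k * \<delta>\<close>, contrary to \<open>evD\<close>.\<close>
    have off: "\<forall>\<^sub>F k in sequentially. x (Suc k) $ i = 0"
      using evG evD
    proof eventually_elim
      case (elim k)
      show ?case
      proof (rule ccontr)
        assume "x (Suc k) $ i \<noteq> 0"
        then have "a k * G k $ i = - D k $ i" using G_supp[of i k] by (simp add: supp_def)
        moreover have "a k * G k $ i < a k * (- \<delta>)"
          using elim(1) a(1)[of k] by (intro mult_strict_left_mono) auto
        moreover have "\<bar>D k $ i\<bar> \<le> norm (D k)" by (rule component_le_norm_cart)
        ultimately show False using elim(2) by simp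
      qed
    qed
    then have off': "\<forall>\<^sub>F k in sequentially. x k $ i = 0"
      by (subst (asm) eventually_sequentially_Suc)
    have full: "\<forall>\<^sub>F k in sequentially. card (supp (x (Suc k))) = s \<and>
        (\<forall>j\<in>supp (x (Suc k)). a k * \<delta> \<le> x (Suc k) $ j)"
      using evG off off'
    proof eventually_elim
      case (elim k)
      have "a k * \<delta> \<le> a k * (- G k $ i)"
        using elim(1) a(1)[of k] by (intro mult_left_mono) auto
      \<comment> \<open>The old coordinate \<open>i\<close> is 0, so the gradient step makes it
        positive although the projection drops it; \<open>proj_feasible_unselected\<close> then
        applies.\<close>
      then have v: "a k * \<delta> \<le> (x k - a k *\<^sub>R G k) $ i" using elim(3) by simp
      then have "0 < (x k - a k *\<^sub>R G k) $ i" using a(1)[of k] \<delta>(1) by (meson less_le_trans mult_pos_pos)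
      from proj_feasible_unselected[OF proj elim(2) this] show ?case
        using v by (force simp: supp_def)
    qed
    then have full': "\<forall>\<^sub>F k in sequentially. card (supp (x k)) = s"
      by (subst eventually_sequentially_Suc[symmetric]) (auto elim: eventually_mono)
    \<comment> \<open>A selected coordinate is at least \<open>a k * \<delta>\<close> after the step
      but moved by less, so it was already nonzero; equal cardinalities turn inclusion into
      equality.\<close>
    have "\<forall>\<^sub>F k in sequentially. supp (x (Suc k)) = supp (x k)"
      using evD full full'
    proof eventually_elim
      case (elim k)
      have "supp (x (Suc k)) \<subseteq> supp (x k)"
      proof
        fix j assume "j \<in> supp (x (Suc k))"
        then have "a k * \<delta> \<le> x (Suc k) $ j" using elim(2) by blast
        moreover have "\<bar>D k $ j\<bar> \<le> norm (D k)" by (rule component_le_norm_cart)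
        ultimately show "j \<in> supp (x k)"
          using elim(1) by (auto simp: D_def supp_def)
      qed
      then show ?case using elim by (intro card_subset_eq) auto
    qed
    then obtain N where N: "\<And>k. k \<ge> N \<Longrightarrow> supp (x (Suc k)) = supp (x k)"
      unfolding eventually_sequentially by blast
    define J where "J = supp (x N)"
    have J: "supp (x k) = J" if "k \<ge> N" for k
      using that by (induction k rule: dec_induct) (auto simp: J_def N)
    have "card J = s"
      using full' J unfolding eventually_sequentially by (metis nat_le_linear)
    then have "\<not> J \<subseteq> supp p" using small card_mono[of "supp p" J] by auto
    then obtain j where j: "j \<in> J" "p $ j = 0" by (auto simp: supp_def)
    have evJ: "\<forall>\<^sub>F k in sequentially. N \<le> k" by (rule eventually_ge_at_top)
    \<comment> \<open>The coordinate \<open>j\<close> vanishes in the limit but is at least \<open>a k * \<delta>\<close> along the sequence.\<close>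
    have "a \<longlonglongrightarrow> 0"
    proof (rule Lim_null_comparison)
      show "(\<lambda>k. x (Suc k) $ j / \<delta>) \<longlonglongrightarrow> 0"
        using LIMSEQ_Suc[OF comp[of j]] j(2) by (auto intro: tendsto_divide_zero)
      show "\<forall>\<^sub>F k in sequentially. norm (a k) \<le> x (Suc k) $ j / \<delta>"
        using full evJ
      proof eventually_elim
        case (elim k)
        then show ?case using J[of "Suc k"] j(1) a(1)[of k] \<delta>(1) by (simp add: field_simps)
      qed
    qed
    then have "\<forall>\<^sub>F k in sequentially. a k < c" using c by (rule order_tendstoD)
    then have "\<forall>\<^sub>F k in sequentially. x (Suc k) = x k"
      using evJ
    proof eventually_elim
      case (elim k)
      have "a k * (G k $ i * D k $ i) = - (D k $ i * D k $ i)" for i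
      proof (cases "i \<in> J")
        case True
        then show ?thesis
          using G_supp[of i k] J[of "Suc k"] elim(2) by (simp flip: mult.assoc)
      next
        case False
        then have "i \<notin> supp (x k)" "i \<notin> supp (x (Suc k))"
          using J[of k] J[of "Suc k"] elim(2) by simp_all
        then have "D k $ i = 0" by (simp add: D_def supp_def)
        then show ?thesis by simp
      qed
      then have "a k * (G k \<bullet> D k) = - (norm (D k))\<^sup>2"
        by (simp add: inner_vec_def sum_distrib_left sum_negf power2_norm_eq_inner)
      then have "G k \<bullet> D k = - ((norm (D k))\<^sup>2 / a k)"
        using a(1)[of k] by (simp add: field_simps)
      moreover have "r (x k) + G k \<bullet> D k \<le> r (x (Suc k))"
        unfolding r_def G_def D_def by (rule objective_convex)
      ultimately have "c * ((norm (D k))\<^sup>2 / (a k)\<^sup>2) \<le> (norm (D k))\<^sup>2 / a k"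
        using dec[of k] by linarith
      then have "c * (norm (D k))\<^sup>2 \<le> a k * (norm (D k))\<^sup>2"
        using a(1)[of k] by (simp add: field_simps power2_eq_square)
      then have "norm (D k) = 0"
        using elim(1) by (simp add: mult_le_cancel_right)
      then show ?case by (simp add: D_def)
    qed
    then obtain N' where N': "\<And>k. k \<ge> N' \<Longrightarrow> x (Suc k) = x k"
      unfolding eventually_sequentially by blast
    have const: "x k = x N'" if "k \<ge> N'" for k
      using that by (induction k rule: dec_induct) (auto simp: N')
    have "x \<longlonglongrightarrow> x N'"
      by (rule tendsto_eventually, rule eventually_sequentiallyI[of N'], rule const)
    then have "p = x (max N N')"
      using LIMSEQ_unique[OF lim] const[of "max N N'"] by simp
    then have "supp p = J" using J by simp
    then show False using small \<open>card J = s\<close> by simp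
  qed
  then have "local_minimizer (objective A b) (feasible s) p"
    using pF by (intro local_minimizer_objective[OF pfeas]) (auto simp: F_def r_def)
  then show ?thesis using lim by blast
qed

end
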